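(* Let $E=\{E_1,\dots,E_m\}$ be the edge set of a bar framework on $n$ vertices in $\mathbb{R}^d$, let $k\in\{1,\dots,m\}$, and let lengths $l_i$ ($i\ne k$) be given. Suppose $p^*\in\mathbb{R}^{nd}$ is a strict local solution up to rigid body motions to either $P_k^+$ or $P_k^-$. Then the framework $(p^*,E)$ is locally rigid. Furthermore, if $E$ is isostatic or under-constrained, then $(p^*,E)$ is not first-order rigid.
   Context: A bar framework $(p,E)$ in $\mathbb{R}^d$ consists of vertex positions $p=(p_1,\dots,p_n)\in\mathbb{R}^{nd}$, $p_i\in\mathbb{R}^d$, and edges $E=\{E_1,\dots,E_m\}$, each joining two distinct vertices; the endpoints of $E_i$ are denoted $p_{i,1},p_{i,2}$. Set $f_i(p)=|p_{i,1}-p_{i,2}|^2$. The rigidity matrix $R(p)\in\mathbb{R}^{m\times nd}$ has $i$th row $\nabla f_i(p)$. A point $q\in\mathbb{R}^{nd}$ is congruent to $p$ if it is obtained by applying an isometry of $\mathbb{R}^d$ to all the vertices of $p$. The space of trivial flexes is $\mathcal{T}(p)=\{v\in\mathbb{R}^{nd}: v_i=Ap_i+b,\ A\in\mathbb{R}^{d\times d}\text{ skew-symmetric},\ b\in\mathbb{R}^d\}$. The framework $(p,E)$ is locally rigid if there is a neighborhood $U$ of $p$ such that any $q\in U$ with the same edge lengths as $p$ (i.e. $f_i(q)=f_i(p)$ for all $i=1,\dots,m$) is congruent to $p$. It is first-order rigid if there is no nontrivial infinitesimal flex, i.e. no $v$ with $R(p)v=0$ and $v\notin\mathcal{T}(p)$.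 The edge set is isostatic if $m+\frac{d(d+1)}{2}=nd$ and under-constrained if $m+\frac{d(d+1)}{2}<nd$. Problem $P_k^{\pm}$ is: $\min_{p\in\mathbb{R}^{nd}} \pm f_k(p)$ subject to $f_i(p)=l_i^2$ for $i=1,\dots,m$, $i\ne k$ ($P_k^+$ minimizes $f_k$, $P_k^-$ maximizes $f_k$). A point is feasible if it satisfies the constraints. A point $p^*$ is a strict local solution of $P_k^+$ (resp. $P_k^-$) up to rigid body motions if $p^*$ is feasible and there is a neighborhood $U$ of $p^*$ such that every feasible $q\in U$ not congruent to $p^*$ has $f_k(q)>f_k(p^* )$ (resp. $f_k(q)<f_k(p^* )$). *)

theory Defs
  imports "HOL-Analysis.Analysis"
begin

text \<open>
  A configuration of \<open>n\<close> points in \<open>d\<close>-space is a vector of type \<open>real^'d^'n\<close>, with \<open>n = CARD('n)\<close>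
  and \<open>d = CARD('d)\<close>; its topology and inner product are those of Euclidean space of dimension
  \<open>nd\<close>. The \<open>m = CARD('m)\<close> edges are a family of vertex pairs indexed by \<open>'m\<close>. The order of the
  two endpoints carries no meaning, so distinctness of the edges is distinctness of the unordered
  endpoint pairs.
\<close>

definition edge_family :: "('m::finite \<Rightarrow> 'n::finite \<times> 'n) \<Rightarrow> bool" where
  "edge_family E \<longleftrightarrow>
     (\<forall>i. fst (E i) \<noteq> snd (E i)) \<and> inj (\<lambda>i. {fst (E i), snd (E i)})"

definition sq_len ::
    "('m::finite \<Rightarrow> 'n::finite \<times> 'n) \<Rightarrow> 'm \<Rightarrow> real^'d::finite^'n \<Rightarrow> real" where
  "sq_len E i p = (norm (p $ fst (E i) - p $ snd (E i)))\<^sup>2"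

definition gradient :: "('a::real_inner \<Rightarrow> real) \<Rightarrow> 'a \<Rightarrow> 'a" where
  "gradient f x = (THE D. GDERIV f x :> D)"

text \<open>The identification of \<open>real^'d^'n\<close> with the space of column vectors of length \<open>nd\<close>.\<close>

definition flatten :: "real^'d::finite^'n::finite \<Rightarrow> real^('n \<times> 'd)" where
  "flatten v = (\<chi> c. v $ fst c $ snd c)"

definition rigidity_matrix ::
    "('m::finite \<Rightarrow> 'n::finite \<times> 'n) \<Rightarrow> real^'d::finite^'n \<Rightarrow> real^('n \<times> 'd)^'m" where
  "rigidity_matrix E p = (\<chi> i. flatten (gradient (sq_len E i) p))"

definition congruent_config :: "real^'d::finite^'n::finite \<Rightarrow> real^'d^'n \<Rightarrow> bool" where
  "congruent_config q p \<longleftrightarrow>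
     (\<exists>\<phi> :: real^'d \<Rightarrow> real^'d. (\<forall>x y. dist (\<phi> x) (\<phi> y) = dist x y) \<and> (\<forall>j. q $ j = \<phi> (p $ j)))"

definition trivial_flexes :: "real^'d::finite^'n::finite \<Rightarrow> (real^'d^'n) set" where
  "trivial_flexes p =
     {v. \<exists>(A :: real^'d^'d) (b :: real^'d). transpose A = - A \<and> (\<forall>j. v $ j = A *v (p $ j) + b)}"

definition locally_rigid ::
    "('m::finite \<Rightarrow> 'n::finite \<times> 'n) \<Rightarrow> real^'d::finite^'n \<Rightarrow> bool" where
  "locally_rigid E p \<longleftrightarrow>
     (\<exists>U. open U \<and> p \<in> U \<and>
        (\<forall>q\<in>U. (\<forall>i. sq_len E i q = sq_len E i p) \<longrightarrow> congruent_config q p))"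

definition first_order_rigid ::
    "('m::finite \<Rightarrow> 'n::finite \<times> 'n) \<Rightarrow> real^'d::finite^'n \<Rightarrow> bool" where
  "first_order_rigid E p \<longleftrightarrow>
     \<not> (\<exists>v. rigidity_matrix E p *v flatten v = 0 \<and> v \<notin> trivial_flexes p)"

definition isostatic :: "nat \<Rightarrow> ('m::finite \<Rightarrow> 'n::finite \<times> 'n) \<Rightarrow> bool" where
  "isostatic d E \<longleftrightarrow> CARD('m) + (d * (d + 1)) div 2 = CARD('n) * d"

definition under_constrained :: "nat \<Rightarrow> ('m::finite \<Rightarrow> 'n::finite \<times> 'n) \<Rightarrow> bool" where
  "under_constrained d E \<longleftrightarrow> CARD('m) + (d * (d + 1)) div 2 < CARD('n) * d"

text \<open>
  The problems \<open>P\<^sub>k\<^sup>+\<close> (minimise the squared length of edge \<open>k\<close>) and \<open>P\<^sub>k\<^sup>-\<close> (maximise it), with the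
  lengths \<open>l i\<close> of all other edges prescribed; the value \<open>l k\<close> is not used.
\<close>

definition feasible ::
    "('m::finite \<Rightarrow> 'n::finite \<times> 'n) \<Rightarrow> ('m \<Rightarrow> real) \<Rightarrow> 'm \<Rightarrow> real^'d::finite^'n \<Rightarrow> bool" where
  "feasible E l k p \<longleftrightarrow> (\<forall>i. i \<noteq> k \<longrightarrow> sq_len E i p = (l i)\<^sup>2)"

definition strict_local_solution_plus ::
    "('m::finite \<Rightarrow> 'n::finite \<times> 'n) \<Rightarrow> ('m \<Rightarrow> real) \<Rightarrow> 'm \<Rightarrow> real^'d::finite^'n \<Rightarrow> bool" where
  "strict_local_solution_plus E l k p \<longleftrightarrow>
     feasible E l k p \<and>
     (\<exists>U. open U \<and> p \<in> U \<and>
        (\<forall>q\<in>U. feasible E l k q \<and> \<not> congruent_config q p \<longrightarrow> sq_len E k q > sq_len E k p))"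

definition strict_local_solution_minus ::
    "('m::finite \<Rightarrow> 'n::finite \<times> 'n) \<Rightarrow> ('m \<Rightarrow> real) \<Rightarrow> 'm \<Rightarrow> real^'d::finite^'n \<Rightarrow> bool" where
  "strict_local_solution_minus E l k p \<longleftrightarrow>
     feasible E l k p \<and>
     (\<exists>U. open U \<and> p \<in> U \<and>
        (\<forall>q\<in>U. feasible E l k q \<and> \<not> congruent_config q p \<longrightarrow> sq_len E k q < sq_len E k p))"

text \<open>The gradient in the rows of the rigidity matrix exists, so the definite description is proper.\<close>

lemma gradient_eq:
  assumes "GDERIV f x :> D"
  shows "gradient f x = D"
  unfolding gradient_def
proof (rule the_equality)
  show "GDERIV f x :> D" by (rule assms)
next
  fix D' assume "GDERIV f x :> D'"
  then have "(\<lambda>h. h \<bullet> D') = (\<lambda>h. h \<bullet> D)"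
    using assms has_derivative_unique unfolding gderiv_def by blast
  then have "h \<bullet> D' = h \<bullet> D" for h
    by (rule fun_cong)
  then show "D' = D"
    by (metis vector_eq_rdot inner_commute)
qed

lemma gderiv_sq_len:
  fixes p :: "real^'d::finite^'n::finite" and E :: "'m::finite \<Rightarrow> 'n \<times> 'n" and i :: 'm
  defines "a \<equiv> fst (E i)" and "b \<equiv> snd (E i)"
  shows "GDERIV (sq_len E i) p :> axis a (2 *\<^sub>R (p $ a - p $ b)) - axis b (2 *\<^sub>R (p $ a - p $ b))"
proof -
  have e: "sq_len E i = (\<lambda>q :: real^'d^'n. (q $ a - q $ b) \<bullet> (q $ a - q $ b))"
    by (simp add: fun_eq_iff sq_len_def a_def b_def power2_norm_eq_inner)
  have "((\<lambda>q :: real^'d^'n. (q $ a - q $ b) \<bullet> (q $ a - q $ b)) has_derivative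
      (\<lambda>h. (p $ a - p $ b) \<bullet> (h $ a - h $ b) + (h $ a - h $ b) \<bullet> (p $ a - p $ b))) (at p)"
    by (intro has_derivative_inner has_derivative_diff
        bounded_linear_imp_has_derivative bounded_linear_vec_nth)
  then show ?thesis
    unfolding gderiv_def e
    by (rule has_derivative_eq_rhs)
      (simp add: fun_eq_iff inner_diff_right inner_diff_left inner_axis inner_commute algebra_simps)
qed

end

theory Submission
  imports Defs
begin

text \<open>
  Local rigidity is immediate: a configuration near \<open>p\<close> with all edge lengths equal to those of
  \<open>p\<close> is feasible and has the same objective value as \<open>p\<close>, which strictness permits only for
  configurations congruent to \<open>p\<close>.

  The second part combines a dimension count with the open mapping property of submersions. The
  rigidity matrix is the derivative at \<open>p\<close> of the map that sends a configuration to its vector of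
  squared edge lengths (\<open>has_derivative_measurement\<close>). The trivial flexes form a space of dimension
  at most \<open>d(d+1)/2\<close>, since translations and infinitesimal rotations in the coordinate planes
  span it (\<open>dim_trivial_flexes_le\<close>). If \<open>p\<close> were first-order rigid, the kernel of the rigidity
  matrix would lie in that space, so its rank would be at least \<open>nd - d(d+1)/2\<close>. When the edge set
  has at most that many edges, the derivative is therefore onto (\<open>surj_rigidity_map\<close>), and every
  vector of squared lengths close to that of \<open>p\<close> is realised by a configuration close to \<open>p\<close>
  (\<open>realise_nearby_measurement\<close>). In particular the length of edge \<open>k\<close> alone can be increased or
  decreased slightly. The result is a feasible configuration that is not congruent to \<open>p\<close> and has
  a better objective value, in the minimisation as well as in the maximisation problem.
\<close>

section \<open>The squared edge lengths as a smooth map\<close>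

definition measurement ::
    "('m::finite \<Rightarrow> 'n::finite \<times> 'n) \<Rightarrow> real^'d::finite^'n \<Rightarrow> real^'m" where
  "measurement E q = (\<chi> i. sq_len E i q)"

lemma inner_flatten: "flatten x \<bullet> flatten y = x \<bullet> y"
proof -
  have "flatten x \<bullet> flatten y = (\<Sum>c\<in>UNIV \<times> UNIV. x $ fst c $ snd c * y $ fst c $ snd c)"
    by (simp add: inner_vec_def flatten_def)
  also have "\<dots> = x \<bullet> y"
    by (simp add: inner_vec_def sum.cartesian_product split_def)
  finally show ?thesis .
qed

lemma rigidity_map_component:
  "(rigidity_matrix E p *v flatten v) $ i = v \<bullet> gradient (sq_len E i) p"
  by (simp add: matrix_vector_mul_component rigidity_matrix_def inner_flatten inner_commute)

lemma has_derivative_measurement: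
  fixes E :: "'m::finite \<Rightarrow> 'n::finite \<times> 'n" and p :: "real^'d::finite^'n"
  shows "(measurement E has_derivative (\<lambda>v. rigidity_matrix E p *v flatten v)) (at p)"
proof -
  have "((\<lambda>q. \<chi> i. sq_len E i q) has_derivative
      (\<lambda>v. \<chi> i. v \<bullet> gradient (sq_len E i) p)) (at p)"
  proof (subst has_derivative_componentwise_within, rule ballI)
    fix b :: "real^'m"
    assume "b \<in> Basis"
    then obtain i where b: "b = axis i 1"
      by (auto simp: Basis_vec_def)
    have "(sq_len E i has_derivative (\<lambda>v. v \<bullet> gradient (sq_len E i) p)) (at p)"
      using gderiv_sq_len[of E i p] gradient_eq[OF gderiv_sq_len[of E i p]]
      by (simp add: gderiv_def)
    then show "((\<lambda>q. (\<chi> i. sq_len E i q) \<bullet> b) has_derivative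
        (\<lambda>v. (\<chi> i. v \<bullet> gradient (sq_len E i) p) \<bullet> b)) (at p)"
      by (simp add: b inner_axis)
  qed
  moreover have "(\<lambda>v. \<chi> i. v \<bullet> gradient (sq_len E i) p) = (\<lambda>v. rigidity_matrix E p *v flatten v)"
    by (simp add: fun_eq_iff vec_eq_iff rigidity_map_component)
  ultimately show ?thesis
    by (simp add: measurement_def[abs_def])
qed

lemma linear_rigidity_map: "linear (\<lambda>v. rigidity_matrix E p *v flatten v)"
  using has_derivative_measurement by (rule has_derivative_linear)

text \<open>
  A linear right inverse of the derivative is all that the open mapping theorem of Sussmann needs;
  it exists in finite dimension as soon as the derivative is onto.
\<close>

lemma realise_nearby_measurement:
  fixes E :: "'m::finite \<Rightarrow> 'n::finite \<times> 'n" and p :: "real^'d::finite^'n"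
  assumes "surj (\<lambda>v. rigidity_matrix E p *v flatten v)" "open U" "p \<in> U"
  obtains e where "e > 0" "ball (measurement E p) e \<subseteq> measurement E ` U"
proof -
  obtain g where g: "linear g" "(\<lambda>v. rigidity_matrix E p *v flatten v) \<circ> g = id"
    using linear_surjective_right_inverse[OF linear_rigidity_map assms(1)] by blast
  have "isCont (measurement E) q" for q :: "real^'d^'n"
    by (rule has_derivative_continuous[OF has_derivative_measurement])
  then have "continuous_on UNIV (measurement E :: real^'d^'n \<Rightarrow> real^'m)"
    by (simp add: continuous_on_eq_continuous_at)
  then have "measurement E p \<in> interior (measurement E ` U)"
    using has_derivative_measurement g assms(2,3)
    by (intro sussmann_open_mapping[of UNIV])
       (auto simp: linear_conv_bounded_linear interior_open)
  then show ?thesis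
    using that by (auto simp: mem_interior)
qed

section \<open>The dimension of the space of trivial flexes\<close>

text \<open>
  For \<open>i \<noteq> k\<close> this is the velocity field of the rotation in the plane of the coordinates
  \<open>i\<close> and \<open>k\<close>. The diagonal indices, where that field would vanish, are used for the translations,
  so that the unordered pairs of coordinates, repetition allowed, index a complete set of
  generators up to sign.
\<close>

definition flex_generator :: "real^'d::finite^'n::finite \<Rightarrow> 'd \<Rightarrow> 'd \<Rightarrow> real^'d^'n" where
  "flex_generator p i k = (if i = k then \<chi> j. axis i 1
     else \<chi> j. (p $ j $ k) *\<^sub>R axis i 1 - (p $ j $ i) *\<^sub>R axis k 1)"

text \<open>
  Skew-symmetry gives \<open>A x = (1/2) \<Sum> A\<^sub>i\<^sub>k (x\<^sub>k e\<^sub>i - x\<^sub>i e\<^sub>k)\<close>, which is a combination of plane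
  rotations; the translation part is expanded in the standard basis.
\<close>

lemma trivial_flex_in_span:
  assumes "v \<in> trivial_flexes p"
  shows "v \<in> span {flex_generator p i k | i k. True}"
proof -
  obtain A b where A: "transpose A = - A" and v: "\<And>j. v $ j = A *v (p $ j) + b"
    using assms unfolding trivial_flexes_def by blast
  have skew: "A $ k $ i = - A $ i $ k" for i k
    using arg_cong[OF A, of "\<lambda>M. M $ i $ k"] by (simp add: transpose_def)
  then have diag: "A $ i $ i = 0" for i
    by (metis neg_equal_zero)
  have "v = (\<Sum>i\<in>UNIV. b $ i *\<^sub>R flex_generator p i i)
      + (\<Sum>i\<in>UNIV. \<Sum>k\<in>UNIV. (A $ i $ k / 2) *\<^sub>R flex_generator p i k)"
  proof -
    have "v $ j $ r = b $ r + (\<Sum>i\<in>UNIV. \<Sum>k\<in>UNIV.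
        (A $ i $ k / 2) * flex_generator p i k $ j $ r)" for j r
    proof -
      have g: "(A $ i $ k / 2) * flex_generator p i k $ j $ r =
          (if i = r then A $ i $ k / 2 * p $ j $ k else 0)
          - (if k = r then A $ i $ k / 2 * p $ j $ i else 0)" for i k
        by (cases "i = k") (auto simp: flex_generator_def axis_def diag)
      have "(\<Sum>i\<in>UNIV. \<Sum>k\<in>UNIV. if i = r then A $ i $ k / 2 * p $ j $ k else 0)
          = (\<Sum>k\<in>UNIV. A $ r $ k / 2 * p $ j $ k)"
        by (subst sum.swap) simp
      moreover have "(\<Sum>i\<in>UNIV. \<Sum>k\<in>UNIV. if k = r then A $ i $ k / 2 * p $ j $ i else 0)
          = - (\<Sum>i\<in>UNIV. A $ r $ i / 2 * p $ j $ i)"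
        by (simp add: sum_negf[symmetric] skew[of _ r])
      ultimately have "(\<Sum>i\<in>UNIV. \<Sum>k\<in>UNIV. (A $ i $ k / 2) * flex_generator p i k $ j $ r)
          = (\<Sum>k\<in>UNIV. A $ r $ k / 2 * p $ j $ k) + (\<Sum>k\<in>UNIV. A $ r $ k / 2 * p $ j $ k)"
        by (simp only: g sum_subtractf diff_minus_eq_add)
      also have "\<dots> = (A *v (p $ j)) $ r"
        by (simp add: matrix_vector_mult_def flip: sum.distrib)
      finally show ?thesis
        by (simp add: v)
    qed
    moreover have "(\<Sum>i\<in>UNIV. b $ i * flex_generator p i i $ j $ r) = b $ r" for j r
      by (simp add: flex_generator_def axis_def if_distrib cong: if_cong)
    ultimately show ?thesis
      by (simp add: vec_eq_iff)
  qed
  moreover have "flex_generator p i k \<in> span {flex_generator p i k | i k. True}" for i k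
    by (rule span_base) blast
  ultimately show ?thesis
    by (simp add: span_add span_sum span_scale)
qed

lemma flex_generator_swap:
  "i \<noteq> k \<Longrightarrow> flex_generator p k i = - flex_generator p i k"
  by (simp add: flex_generator_def vec_eq_iff)

text \<open>
  Exchanging the two indices changes a rotation generator only by a sign. After enumerating the
  coordinates by \<open>h\<close> it is enough to keep the generators of the pairs on or above the diagonal,
  and there are \<open>d(d+1)/2\<close> such pairs.
\<close>

lemma dim_trivial_flexes_le:
  fixes p :: "real^'d::finite^'n::finite"
  shows "dim (trivial_flexes p) \<le> CARD('d) * (CARD('d) + 1) div 2"
proof -
  obtain h :: "'d \<Rightarrow> nat" where h: "bij_betw h UNIV {0..<CARD('d)}"
    using ex_bij_betw_finite_nat[of "UNIV :: 'd set"] by auto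
  then have inj: "h i = h k \<longleftrightarrow> i = k" for i k
    by (auto simp: bij_betw_def inj_on_def)
  define P where "P = {(i, k). h i \<le> h k}"
  define G where "G = (\<lambda>(i, k). flex_generator p i k) ` P"
  have "flex_generator p i k \<in> span G" for i k
  proof (cases "h i \<le> h k")
    case True
    then show ?thesis
      by (auto simp: G_def P_def intro!: span_base)
  next
    case False
    then have "flex_generator p k i \<in> span G"
      by (auto simp: G_def P_def intro!: span_base)
    then show ?thesis
      using False flex_generator_swap[of k i p] span_neg by fastforce
  qed
  then have "span {flex_generator p i k | i k. True} \<subseteq> span G"
    by (intro span_minimal) auto
  then have "trivial_flexes p \<subseteq> span G"
    using trivial_flex_in_span by blast
  then have "dim (trivial_flexes p) \<le> card G"
    by (rule dim_le_card) (simp add: G_def)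
  also have "\<dots> \<le> card P"
    unfolding G_def by (rule card_image_le) simp
  also have "card P = CARD('d) * (CARD('d) + 1) div 2"
  proof -
    \<comment> \<open>Inclusion-exclusion for \<open>P\<close> and its mirror image gives \<open>2 |P| = d\<^sup>2 + d\<close>.\<close>
    have "card P + card (P\<inverse>) = card (P \<union> P\<inverse>) + card (P \<inter> P\<inverse>)"
      by (rule card_Un_Int) simp_all
    moreover have "P \<union> P\<inverse> = UNIV" "P \<inter> P\<inverse> = (\<lambda>i. (i, i)) ` UNIV"
      by (auto simp: P_def inj)
    moreover have "card (P\<inverse>) = card P"
      by (rule card_inverse)
    moreover have "card ((\<lambda>i::'d. (i, i)) ` UNIV) = CARD('d)"
      by (rule card_image) (simp add: inj_on_def)
    ultimately have "2 * card P = CARD('d) * (CARD('d) + 1)"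
      by (simp add: card_cartesian_product flip: UNIV_Times_UNIV)
    then show ?thesis
      by simp
  qed
  finally show ?thesis .
qed

section \<open>First-order rigidity and the rank of the rigidity matrix\<close>

text \<open>
  A linear map is injective on the orthogonal complement of its kernel, so the range is at least
  as large as that complement.
\<close>

lemma DIM_le_rank_plus_nullity:
  fixes L :: "'a::euclidean_space \<Rightarrow> 'b::euclidean_space"
  assumes "linear L"
  shows "DIM('a) \<le> dim (range L) + dim {v. L v = 0}"
proof -
  define K where "K = {v. L v = 0}"
  define C where "C = {y \<in> UNIV. \<forall>x\<in>K. orthogonal x y}"
  have K: "subspace K"
    unfolding K_def by (rule linear_subspace_kernel[OF assms])
  have C: "subspace C"
    by (auto simp: C_def subspace_def orthogonal_clauses)
  have "inj_on L (span C)"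
  proof (subst linear_injective_on_subspace_0[OF assms subspace_span], intro ballI impI)
    fix x
    assume "x \<in> span C" "L x = 0"
    then have "orthogonal x x"
      using C by (auto simp: C_def K_def span_eq_iff[THEN iffD2])
    then show "x = 0"
      by (simp add: orthogonal_def)
  qed
  then have "dim C = dim (L ` C)"
    by (simp add: dim_image_eq assms)
  also have "\<dots> \<le> dim (range L)"
    by (rule dim_subset) blast
  finally show ?thesis
    using dim_subspace_orthogonal_to_vectors[OF K subspace_UNIV]
    by (simp add: C_def K_def)
qed

lemma surj_rigidity_map:
  fixes p :: "real^'d::finite^'n::finite" and E :: "'m::finite \<Rightarrow> 'n \<times> 'n"
  assumes rigid: "first_order_rigid E p"
    and few_edges: "CARD('m) + CARD('d) * (CARD('d) + 1) div 2 \<le> CARD('n) * CARD('d)"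
  shows "surj (\<lambda>v. rigidity_matrix E p *v flatten v)"
proof -
  define L where "L = (\<lambda>v. rigidity_matrix E p *v flatten v)"
  have L: "linear L"
    unfolding L_def by (rule linear_rigidity_map)
  have "dim {v. L v = 0} \<le> dim (trivial_flexes p)"
    using rigid by (intro dim_subset) (auto simp: first_order_rigid_def L_def)
  then have "dim {v. L v = 0} \<le> CARD('d) * (CARD('d) + 1) div 2"
    using dim_trivial_flexes_le order_trans by blast
  then have "DIM(real^'m) \<le> dim (range L)"
    using DIM_le_rank_plus_nullity[OF L] few_edges by simp
  then have "dim (range L) = DIM(real^'m)"
    using dim_subset_UNIV le_antisym by blast
  then have "span (range L) = UNIV"
    by (simp only: dim_eq_full)
  then show ?thesis
    using L by (simp add: L_def span_eq_iff[THEN iffD2] linear_subspace_image)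
qed

section \<open>Varying one edge length\<close>

lemma congruent_config_sq_len:
  "congruent_config q p \<Longrightarrow> sq_len E i q = sq_len E i p"
  by (auto simp: congruent_config_def sq_len_def simp flip: dist_norm)

text \<open>
  The sign \<open>s\<close> lets a single statement serve both the minimisation and the maximisation problem.
  Non-congruence comes for free, because the length of edge \<open>k\<close> has changed.
\<close>

lemma vary_one_edge_length:
  fixes p :: "real^'d::finite^'n::finite" and E :: "'m::finite \<Rightarrow> 'n \<times> 'n" and s :: real
  assumes "surj (\<lambda>v. rigidity_matrix E p *v flatten v)" "feasible E l k p"
    and "open U" "p \<in> U" "s \<noteq> 0"
  obtains q where "q \<in> U" "feasible E l k q" "\<not> congruent_config q p"
    "s * sq_len E k q > s * sq_len E k p"
proof -
  obtain e where e: "e > 0" "ball (measurement E p) e \<subseteq> measurement E ` U"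
    using realise_nearby_measurement assms(1,3,4) by blast
  have "norm (axis k (sgn s * e / 2) :: real^'m) = e / 2"
    using e(1) assms(5) by (simp add: norm_eq_sqrt_inner inner_axis_axis sgn_if real_sqrt_divide)
  then have "measurement E p + axis k (sgn s * e / 2) \<in> ball (measurement E p) e"
    using e(1) by (simp add: dist_norm)
  then obtain q where q: "q \<in> U" "measurement E q = measurement E p + axis k (sgn s * e / 2)"
    using e(2) by fastforce
  have len: "sq_len E i q = sq_len E i p + (if i = k then sgn s * e / 2 else 0)" for i
    using arg_cong[OF q(2), of "\<lambda>x. x $ i"] by (simp add: measurement_def axis_def)
  show ?thesis
  proof (rule that[OF q(1)])
    show "feasible E l k q"
      using assms(2) by (simp add: feasible_def len)
    show "\<not> congruent_config q p"
      using congruent_config_sq_len[of q p E k] e(1) assms(5) by (auto simp: len sgn_0_0)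
    have "s * sgn s > 0"
      using assms(5) by (simp add: sgn_if)
    then show "s * sq_len E k q > s * sq_len E k p"
      using e(1) by (simp add: len distrib_left mult.assoc[symmetric])
  qed
qed

lemma strict_local_solution_imp_locally_rigid:
  assumes "strict_local_solution_plus E l k p \<or> strict_local_solution_minus E l k p"
  shows "locally_rigid E p"
proof -
  have "feasible E l k p"
    using assms by (auto simp: strict_local_solution_plus_def strict_local_solution_minus_def)
  then have feas: "feasible E l k q" if "\<forall>i. sq_len E i q = sq_len E i p" for q
    using that by (simp add: feasible_def)
  obtain U where "open U" "p \<in> U"
    and U: "\<And>q. q \<in> U \<Longrightarrow> feasible E l k q \<Longrightarrow> \<not> congruent_config q p
      \<Longrightarrow> sq_len E k q \<noteq> sq_len E k p"
    using assms
    by (auto simp: strict_local_solution_plus_def strict_local_solution_minus_def) (metis less_irrefl)+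
  then show ?thesis
    unfolding locally_rigid_def using feas by blast
qed

theorem theorem3p3:
  fixes E :: "'m::finite \<Rightarrow> 'n::finite \<times> 'n"
    and k :: 'm
    and l :: "'m \<Rightarrow> real"
    and p :: "real^'d::finite^'n"
  assumes "edge_family E"
    and "strict_local_solution_plus E l k p \<or> strict_local_solution_minus E l k p"
  shows "locally_rigid E p \<and>
    (isostatic CARD('d) E \<or> under_constrained CARD('d) E \<longrightarrow> \<not> first_order_rigid E p)"
proof (intro conjI impI)
  show "locally_rigid E p"
    using assms(2) by (rule strict_local_solution_imp_locally_rigid)
  assume "isostatic CARD('d) E \<or> under_constrained CARD('d) E"
  then have few: "CARD('m) + CARD('d) * (CARD('d) + 1) div 2 \<le> CARD('n) * CARD('d)"
    by (auto simp: isostatic_def under_constrained_def)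
  show "\<not> first_order_rigid E p"
  proof
    assume "first_order_rigid E p"
    then have surj: "surj (\<lambda>v. rigidity_matrix E p *v flatten v)"
      using few by (rule surj_rigidity_map)
    show False
      using assms(2)
    proof
      assume "strict_local_solution_plus E l k p"
      then obtain U where feas: "feasible E l k p" and U: "open U" "p \<in> U"
        and min: "\<And>q. q \<in> U \<Longrightarrow> feasible E l k q \<Longrightarrow> \<not> congruent_config q p
          \<Longrightarrow> sq_len E k q > sq_len E k p"
        by (auto simp: strict_local_solution_plus_def)
      obtain q where "q \<in> U" "feasible E l k q" "\<not> congruent_config q p"
        "- 1 * sq_len E k q > - 1 * sq_len E k p"
        by (rule vary_one_edge_length[OF surj feas U, of "- 1"]) auto
      then show False
        using min[of q] by simp
    next
      assume "strict_local_solution_minus E l k p"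
      then obtain U where feas: "feasible E l k p" and U: "open U" "p \<in> U"
        and max: "\<And>q. q \<in> U \<Longrightarrow> feasible E l k q \<Longrightarrow> \<not> congruent_config q p
          \<Longrightarrow> sq_len E k q < sq_len E k p"
        by (auto simp: strict_local_solution_minus_def)
      obtain q where "q \<in> U" "feasible E l k q" "\<not> congruent_config q p"
        "1 * sq_len E k q > 1 * sq_len E k p"
        by (rule vary_one_edge_length[OF surj feas U, of 1]) auto
      then show False
        using max[of q] by simp
    qed
  qed
qed

end
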